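(* Let $R$ be a finite commutative ring with identity and $P$ a proper prime ideal of $R$ with $m=|P|\geq 2$; let $I=I(\Gamma_P(R))\subseteq S=k[x_1,\ldots,x_a,y_1,\ldots,y_b]$ be the edge ideal of the prime ideal graph. Let $\mathfrak{p}_0=(x_1,\ldots,x_a)$ and, for $1\leq i\leq a$, let $$\mathfrak{p}_i=(x_1,\ldots,\widehat{x_i},\ldots,x_a,y_1,\ldots,y_b),$$ where the hat means that $x_i$ is omitted. Then $$I=\mathfrak{p}_0\cap\mathfrak{p}_1\cap\cdots\cap\mathfrak{p}_a.$$ In particular, $I$ is radical and $\operatorname{Ass}(S/I)=\{\mathfrak{p}_0,\mathfrak{p}_1,\ldots,\mathfrak{p}_a\}$. Thus $S/I$ has exactly $m=|P|$ minimal primes.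
   Context: The prime ideal graph $\Gamma_P(R)$ is the simple graph with vertex set $R\setminus\{0\}$ in which two distinct vertices $x,y$ are adjacent if and only if $xy\in P$. Put $a=|P|-1$ and $b=|P|(|R/P|-1)=|R\setminus P|$. Write $P\setminus\{0\}=\{u_1,\ldots,u_a\}$, $R\setminus P=\{v_1,\ldots,v_b\}$; attach the variable $x_i$ to $u_i$ and $y_\ell$ to $v_\ell$. Let $k$ be a field and $S=k[x_1,\ldots,x_a,y_1,\ldots,y_b]$. The edge ideal $I=I(\Gamma_P(R))$ is the ideal of $S$ generated by the products of the two variables attached to the endpoints of each edge; explicitly $I=(x_ix_j,\;x_iy_\ell \mid 1\leq i<j\leq a,\;1\leq i\leq a,\;1\leq \ell\leq b)$. *)

theory Defs
  imports "HOL-Algebra.QuotRing" "HOL-Algebra.Module" "HOL-Library.Poly_Mapping"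
begin

section \<open>Polynomial rings in a set of variables\<close>

text \<open>
  A monomial is a finitely supported exponent function \<^typ>\<open>'v \<Rightarrow>\<^sub>0 nat\<close>, and a polynomial is a
  finitely supported coefficient function on monomials, with the convolution product of
  \<^theory>\<open>HOL-Library.Poly_Mapping\<close>.  The ring \<open>k[V]\<close> consists of those polynomials in which only
  variables from \<open>V\<close> occur.
\<close>

definition mpoly_ring :: "'v set \<Rightarrow> (('v \<Rightarrow>\<^sub>0 nat) \<Rightarrow>\<^sub>0 'k::field) ring"
  where "mpoly_ring V =
    \<lparr>carrier = {p. \<forall>m\<in>Poly_Mapping.keys p. Poly_Mapping.keys m \<subseteq> V},
     mult = (*), one = 1, zero = 0, add = (+)\<rparr>"

definition var :: "'v \<Rightarrow> (('v \<Rightarrow>\<^sub>0 nat) \<Rightarrow>\<^sub>0 'k::field)"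
  where "var v = Poly_Mapping.single (Poly_Mapping.single v 1) 1"

lemma var_in_mpoly_ring: "v \<in> V \<Longrightarrow> var v \<in> carrier (mpoly_ring V)"
  by (simp add: var_def mpoly_ring_def)

lemma cring_mpoly_ring: "cring (mpoly_ring V :: (('v \<Rightarrow>\<^sub>0 nat) \<Rightarrow>\<^sub>0 'k::field) ring)"
proof (rule cringI)
  show "abelian_group (mpoly_ring V :: (('v \<Rightarrow>\<^sub>0 nat) \<Rightarrow>\<^sub>0 'k) ring)"
  proof (rule abelian_groupI)
    fix p :: "('v \<Rightarrow>\<^sub>0 nat) \<Rightarrow>\<^sub>0 'k"
    assume "p \<in> carrier (mpoly_ring V)"
    then have "- p \<in> carrier (mpoly_ring V)"
      by (simp add: mpoly_ring_def)
    then show "\<exists>q\<in>carrier (mpoly_ring V). q \<oplus>\<^bsub>mpoly_ring V\<^esub> p = \<zero>\<^bsub>mpoly_ring V\<^esub>"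
      by (intro bexI[of _ "- p"]) (simp_all add: mpoly_ring_def)
  next
    fix p q :: "('v \<Rightarrow>\<^sub>0 nat) \<Rightarrow>\<^sub>0 'k"
    assume "p \<in> carrier (mpoly_ring V)" "q \<in> carrier (mpoly_ring V)"
    then show "p \<oplus>\<^bsub>mpoly_ring V\<^esub> q \<in> carrier (mpoly_ring V)"
      using keys_add[of p q] by (auto simp: mpoly_ring_def)
  qed (simp_all add: mpoly_ring_def ac_simps)
  show "Group.comm_monoid (mpoly_ring V :: (('v \<Rightarrow>\<^sub>0 nat) \<Rightarrow>\<^sub>0 'k) ring)"
  proof (rule comm_monoidI)
    fix p q :: "('v \<Rightarrow>\<^sub>0 nat) \<Rightarrow>\<^sub>0 'k"
    assume p: "p \<in> carrier (mpoly_ring V)" and q: "q \<in> carrier (mpoly_ring V)"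
    have "Poly_Mapping.keys m \<subseteq> V" if m: "m \<in> Poly_Mapping.keys (p * q)" for m
    proof -
      obtain a b where "m = a + b" "a \<in> Poly_Mapping.keys p" "b \<in> Poly_Mapping.keys q"
        using m keys_mult[of p q] by blast
      then show ?thesis
        using p q keys_add[of a b] by (simp add: mpoly_ring_def) blast
    qed
    then show "p \<otimes>\<^bsub>mpoly_ring V\<^esub> q \<in> carrier (mpoly_ring V)"
      by (simp add: mpoly_ring_def)
  qed (simp_all add: mpoly_ring_def ac_simps)
qed (simp add: mpoly_ring_def distrib_right)


section \<open>Radical ideals, associated primes and minimal primes\<close>

definition radical :: "('a, 'e) ring_scheme \<Rightarrow> 'a set \<Rightarrow> 'a set"
  where "radical R I = {r \<in> carrier R. \<exists>n::nat. n > 0 \<and> r [^]\<^bsub>R\<^esub> n \<in> I}"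

definition is_radical :: "('a, 'e) ring_scheme \<Rightarrow> 'a set \<Rightarrow> bool"
  where "is_radical R I \<longleftrightarrow> ideal I R \<and> radical R I = I"

definition associated_primes ::
    "('a, 'e) ring_scheme \<Rightarrow> ('a, 'b, 'f) module_scheme \<Rightarrow> 'a set set"
  where "associated_primes R M =
    {p. primeideal p R \<and>
        (\<exists>x\<in>carrier M. p = {r \<in> carrier R. r \<odot>\<^bsub>M\<^esub> x = \<zero>\<^bsub>M\<^esub>})}"

definition minimal_primes :: "('a, 'e) ring_scheme \<Rightarrow> 'a set set"
  where "minimal_primes R =
    {p. primeideal p R \<and> (\<forall>q. primeideal q R \<and> q \<subseteq> p \<longrightarrow> q = p)}"

text \<open>The quotient ring \<open>R/I\<close> as an \<open>R\<close>-module: \<open>r\<close> acts as multiplication by its residue class.\<close>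

definition quot_module :: "('a, 'e) ring_scheme \<Rightarrow> 'a set \<Rightarrow> ('a, 'a set) module"
  where "quot_module R I = ring.extend (R Quot I)
    \<lparr>smult = (\<lambda>r x. (I +>\<^bsub>R\<^esub> r) \<otimes>\<^bsub>R Quot I\<^esub> x)\<rparr>"

lemma quot_module_simps:
  "carrier (quot_module R I) = carrier (R Quot I)"
  "zero (quot_module R I) = zero (R Quot I)"
  "add (quot_module R I) = add (R Quot I)"
  "smult (quot_module R I) = (\<lambda>r x. (I +>\<^bsub>R\<^esub> r) \<otimes>\<^bsub>R Quot I\<^esub> x)"
  by (simp_all add: quot_module_def ring.extend_def)

lemma module_quot_module:
  assumes "cring R" "ideal I R"
  shows "module R (quot_module R I)"
proof -
  interpret R: cring R by fact
  interpret I: ideal I R by fact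
  interpret Q: cring "R Quot I"
    by (rule I.quotient_is_cring) fact
  interpret h: ring_hom_ring R "R Quot I" "(+>\<^bsub>R\<^esub>) I"
    by (rule I.rcos_ring_hom_ring)
  have one: "(I +>\<^bsub>R\<^esub> \<one>\<^bsub>R\<^esub>) \<otimes>\<^bsub>R Quot I\<^esub> x = x" if "x \<in> carrier (R Quot I)" for x
    unfolding h.hom_one by (rule Q.l_one[OF that])
  have "abelian_group (quot_module R I)"
  proof (rule abelian_groupI, unfold quot_module_simps)
    fix x assume "x \<in> carrier (R Quot I)"
    then show "\<exists>y\<in>carrier (R Quot I). y \<oplus>\<^bsub>R Quot I\<^esub> x = \<zero>\<^bsub>R Quot I\<^esub>"
      by (intro bexI[of _ "\<ominus>\<^bsub>R Quot I\<^esub> x"] Q.l_neg Q.a_inv_closed)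
  qed (rule Q.zero_closed | (rule Q.a_closed Q.a_assoc Q.a_comm Q.l_zero; assumption))+
  then show ?thesis
  proof (rule moduleI[OF R.is_cring], unfold quot_module_simps)
    fix r s x y
    assume rs: "r \<in> carrier R" "s \<in> carrier R"
      and xy: "x \<in> carrier (R Quot I)" "y \<in> carrier (R Quot I)"
    note cl = h.hom_closed[OF rs(1)] h.hom_closed[OF rs(2)]
    show "(I +>\<^bsub>R\<^esub> (r \<oplus>\<^bsub>R\<^esub> s)) \<otimes>\<^bsub>R Quot I\<^esub> x
        = (I +>\<^bsub>R\<^esub> r) \<otimes>\<^bsub>R Quot I\<^esub> x \<oplus>\<^bsub>R Quot I\<^esub> (I +>\<^bsub>R\<^esub> s) \<otimes>\<^bsub>R Quot I\<^esub> x"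
      unfolding h.hom_add[OF rs] by (rule Q.l_distr[OF cl xy(1)])
    show "(I +>\<^bsub>R\<^esub> (r \<otimes>\<^bsub>R\<^esub> s)) \<otimes>\<^bsub>R Quot I\<^esub> x
        = (I +>\<^bsub>R\<^esub> r) \<otimes>\<^bsub>R Quot I\<^esub> ((I +>\<^bsub>R\<^esub> s) \<otimes>\<^bsub>R Quot I\<^esub> x)"
      unfolding h.hom_mult[OF rs] by (rule Q.m_assoc[OF cl xy(1)])
    show "(I +>\<^bsub>R\<^esub> r) \<otimes>\<^bsub>R Quot I\<^esub> (x \<oplus>\<^bsub>R Quot I\<^esub> y)
        = (I +>\<^bsub>R\<^esub> r) \<otimes>\<^bsub>R Quot I\<^esub> x \<oplus>\<^bsub>R Quot I\<^esub> (I +>\<^bsub>R\<^esub> r) \<otimes>\<^bsub>R Quot I\<^esub> y"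
      by (rule Q.r_distr[OF xy cl(1)])
    show "(I +>\<^bsub>R\<^esub> r) \<otimes>\<^bsub>R Quot I\<^esub> x \<in> carrier (R Quot I)"
      by (rule Q.m_closed[OF cl(1) xy(1)])
  qed (rule one)
qed


section \<open>Graphs and edge ideals\<close>

text \<open>A simple graph is a pair of a vertex set and a set of two-element sets of vertices.\<close>

type_synonym 'v sgraph = "'v set \<times> 'v set set"

definition prime_ideal_graph :: "('a, 'e) ring_scheme \<Rightarrow> 'a set \<Rightarrow> 'a sgraph"
  where "prime_ideal_graph R P =
    (carrier R - {\<zero>\<^bsub>R\<^esub>},
     {{x, y} | x y. x \<in> carrier R - {\<zero>\<^bsub>R\<^esub>} \<and> y \<in> carrier R - {\<zero>\<^bsub>R\<^esub>} \<and> x \<noteq> y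
        \<and> x \<otimes>\<^bsub>R\<^esub> y \<in> P})"

text \<open>The vertices themselves serve as the names of the variables.\<close>

definition edge_ideal :: "'v sgraph \<Rightarrow> (('v \<Rightarrow>\<^sub>0 nat) \<Rightarrow>\<^sub>0 'k::field) set"
  where "edge_ideal G =
    genideal (mpoly_ring (fst G)) {var x * var y | x y. {x, y} \<in> snd G}"

end

theory Submission
  imports Defs
begin

text \<open>
  In a product of variables indexed by \<open>V = R - {0}\<close>, an edge of the prime ideal graph occurs exactly
  when some variable of \<open>W = P - {0}\<close> occurs together with a different variable: primality of \<open>P\<close> says
  that \<open>x y \<in> P\<close> forces one endpoint into \<open>P\<close>.  Equivalently, the support of the monomial meets \<open>W\<close>, and
  for every \<open>w \<in> W\<close> it also meets \<open>V - {w}\<close>.  The sets \<open>W\<close> and \<open>V - {w}\<close> are thus the minimal vertex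
  covers of the graph.  Since a monomial ideal consists of the polynomials all of whose monomials are
  multiples of generators (\<open>genideal_monomials\<close>), this statement about supports is already the
  decomposition of the edge ideal into ideals generated by variables
  (\<open>edge_ideal_prime_ideal_graph\<close>).

  An ideal generated by variables is prime (\<open>primeideal_hitting_ideal\<close>): if neither factor lies in it,
  look at the monomials of the two factors that avoid these variables.  Some sum of exponents taken
  from the two finite sets arises in only one way (\<open>ex_unique_sum\<close>), so the corresponding monomial
  survives in the product.

  The primes obtained here are pairwise incomparable, and everything else holds for the intersection
  of any finite antichain of primes: it is radical; its colon ideals by ring elements are the
  intersections of subfamilies, which are prime only if they are members of the family; and a prime
  above the intersection contains a member of the family.  The first of the last two facts gives the
  associated primes (\<open>associated_primes_quot_Inter\<close>), the second one the minimal primes of the quotient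
  (\<open>minimal_primes_quot_Inter\<close>).
\<close>


section \<open>Finite intersections of prime ideals\<close>

text \<open>
  If every member \<open>J\<close> of the family had an element outside the prime ideal, the product of these
  elements would lie in all \<open>J\<close> and, by primality, still outside.  The intersection is taken inside
  the carrier, so that the empty family stands for the whole ring.
\<close>

lemma (in primeideal) finite_Inter_subset_imp_subset:
  assumes "finite F" and "\<And>J. J \<in> F \<Longrightarrow> ideal J R"
    and "{r \<in> carrier R. \<forall>J\<in>F. r \<in> J} \<subseteq> I"
  shows "\<exists>J\<in>F. J \<subseteq> I"
proof (rule ccontr)
  assume none: "\<not> (\<exists>J\<in>F. J \<subseteq> I)"
  have "\<exists>r\<in>carrier R - I. \<forall>J\<in>F. r \<in> J"
    using assms(1,2) none
  proof (induction F)
    case empty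
    show ?case
      using I_notcarr a_subset by blast
  next
    case (insert J F)
    from insert.prems(2) obtain s where s: "s \<in> J" "s \<notin> I"
      by auto
    have J: "ideal J R"
      by (simp add: insert.prems(1))
    then have sc: "s \<in> carrier R"
      using s(1) by (rule ideal.Icarr)
    obtain r where r: "r \<in> carrier R - I" "\<forall>K\<in>F. r \<in> K"
      using insert by auto
    have "s \<otimes> r \<in> carrier R - I"
      using I_prime[of s r] s r sc by auto
    moreover have "s \<otimes> r \<in> J"
      using ideal.I_r_closed[OF J s(1)] r by blast
    moreover have "s \<otimes> r \<in> K" if "K \<in> F" for K
      using ideal.I_l_closed[of K R r s] insert.prems(1) r that sc by blast
    ultimately show ?case
      by blast
  qed
  then show False
    using assms(3) by blast
qed

lemma (in primeideal) pow_mem_imp_mem: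
  assumes "r \<in> carrier R" "r [^] (n::nat) \<in> I" "n > 0"
  shows "r \<in> I"
  using assms(2,3)
proof (induction n)
  case (Suc n)
  then have "r [^] n \<in> I \<or> r \<in> I"
    using I_prime[of "r [^] n" r] assms(1) by simp
  then show ?case
  proof
    assume n: "r [^] n \<in> I"
    have "n \<noteq> 0"
    proof
      assume "n = 0"
      with n have "\<one> \<in> I" by simp
      then show False
        using one_imp_carrier I_notcarr by simp
    qed
    with n show ?thesis
      using Suc.IH by simp
  qed
qed simp

locale finite_prime_antichain = cring R for R (structure) +
  fixes F :: "'a set set"
  assumes finite_F: "finite F" and nonempty: "F \<noteq> {}"
    and prime_F: "p \<in> F \<Longrightarrow> primeideal p R"
    and antichain: "\<lbrakk>p \<in> F; q \<in> F; p \<subseteq> q\<rbrakk> \<Longrightarrow> p = q"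
begin

lemma ideal_F: "p \<in> F \<Longrightarrow> ideal p R"
  using prime_F primeideal.axioms(1) by blast

lemma Inter_subset_carrier: "\<Inter>F \<subseteq> carrier R"
  using nonempty ideal_F ideal.Icarr by fastforce

lemma ideal_Inter: "ideal (\<Inter>F) R"
  using nonempty ideal_F by (intro i_Intersect)

lemma prime_contains_member:
  assumes "primeideal p R" "\<Inter>F \<subseteq> p"
  shows "\<exists>q\<in>F. q \<subseteq> p"
  using primeideal.finite_Inter_subset_imp_subset[OF assms(1) finite_F ideal_F] assms(2) by blast

lemma is_radical_Inter: "is_radical R (\<Inter>F)"
proof -
  have "radical R (\<Inter>F) \<subseteq> \<Inter>F"
    using primeideal.pow_mem_imp_mem[OF prime_F] by (fastforce simp: radical_def)
  moreover have "\<Inter>F \<subseteq> radical R (\<Inter>F)"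
  proof
    fix r assume r: "r \<in> \<Inter>F"
    then have rc: "r \<in> carrier R"
      using Inter_subset_carrier by blast
    then have "r [^] (1::nat) \<in> \<Inter>F"
      using r by simp
    with rc show "r \<in> radical R (\<Inter>F)"
      unfolding radical_def by blast
  qed
  ultimately show ?thesis
    using ideal_Inter by (simp add: is_radical_def)
qed

text \<open>
  A prime \<open>q\<close> contains \<open>r x\<close> for every \<open>r\<close> if \<open>x \<in> q\<close>, and only for \<open>r \<in> q\<close> otherwise; hence dividing
  by \<open>x\<close> just drops the primes that contain \<open>x\<close>.
\<close>

lemma colon_Inter:
  assumes "x \<in> carrier R"
  shows "{r \<in> carrier R. r \<otimes> x \<in> \<Inter>F} = {r \<in> carrier R. \<forall>q\<in>{q\<in>F. x \<notin> q}. r \<in> q}"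
proof -
  have "r \<otimes> x \<in> q \<longleftrightarrow> x \<in> q \<or> r \<in> q" if "q \<in> F" "r \<in> carrier R" for q r
  proof -
    interpret q: primeideal q R by (rule prime_F[OF that(1)])
    show ?thesis
      using q.I_prime[of r x] q.I_l_closed[of x r] q.I_r_closed[of r x] that assms by blast
  qed
  then show ?thesis
    by blast
qed

text \<open>
  The members other than \<open>p\<close> have a common element \<open>x\<close> outside \<open>p\<close>, for otherwise one of them would be
  contained in \<open>p\<close>, against incomparability.  Dividing by this \<open>x\<close> drops all members but \<open>p\<close>.
\<close>

lemma ex_colon_Inter_eq:
  assumes p: "p \<in> F"
  shows "\<exists>x\<in>carrier R. {r \<in> carrier R. r \<otimes> x \<in> \<Inter>F} = p"
proof -
  interpret p: primeideal p R by (rule prime_F[OF p])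
  have "\<not> {r \<in> carrier R. \<forall>q\<in>F - {p}. r \<in> q} \<subseteq> p"
    using p.finite_Inter_subset_imp_subset[of "F - {p}"] finite_F ideal_F antichain p by blast
  then obtain x where x: "x \<in> carrier R" "\<forall>q\<in>F - {p}. x \<in> q" "x \<notin> p"
    by blast
  then have "{q\<in>F. x \<notin> q} = {p}"
    using p by blast
  then have "{r \<in> carrier R. r \<otimes> x \<in> \<Inter>F} = p"
    using colon_Inter[OF x(1)] p.a_subset by auto
  with x(1) show ?thesis
    by blast
qed

text \<open>
  The colon ideal is the intersection of those members that avoid \<open>x\<close>; being prime, it contains one of
  them, and it is contained in each of them.
\<close>

lemma prime_colon_Inter_mem:
  assumes x: "x \<in> carrier R" and prime: "primeideal {r \<in> carrier R. r \<otimes> x \<in> \<Inter>F} R"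
  shows "{r \<in> carrier R. r \<otimes> x \<in> \<Inter>F} \<in> F"
proof -
  let ?G = "{q\<in>F. x \<notin> q}" and ?p = "{r \<in> carrier R. r \<otimes> x \<in> \<Inter>F}"
  have eq: "?p = {r \<in> carrier R. \<forall>q\<in>?G. r \<in> q}"
    by (rule colon_Inter[OF x])
  obtain q where q: "q \<in> ?G" "q \<subseteq> ?p"
    using primeideal.finite_Inter_subset_imp_subset[OF prime, of ?G] finite_F ideal_F eq by auto
  moreover have "?p \<subseteq> q"
    unfolding eq using q(1) by blast
  ultimately have "?p = q"
    by blast
  with q(1) show ?thesis
    by simp
qed

end

lemma (in ideal) carrier_quot: "carrier (R Quot I) = (+>) I ` carrier R"
  by (auto simp: FactRing_simps)

text \<open>
  The annihilator of the residue class of \<open>x\<close> is the colon ideal of \<open>I\<close> by \<open>x\<close>, so associated primes can be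
  found without leaving \<open>R\<close>.
\<close>

lemma (in ideal) associated_primes_quot_module:
  "associated_primes R (quot_module R I)
    = {p. primeideal p R \<and> (\<exists>x\<in>carrier R. p = {r \<in> carrier R. r \<otimes> x \<in> I})}"
proof -
  have ann: "(I +> r) \<otimes>\<^bsub>R Quot I\<^esub> (I +> x) = \<zero>\<^bsub>R Quot I\<^esub> \<longleftrightarrow> r \<otimes> x \<in> I"
    if "r \<in> carrier R" "x \<in> carrier R" for r x
  proof -
    have "(I +> r) \<otimes>\<^bsub>R Quot I\<^esub> (I +> x) = I +> (r \<otimes> x)"
      using rcoset_mult_add[OF that] by (simp add: FactRing_def)
    then show ?thesis
      using a_rcos_const[of "r \<otimes> x"] a_rcos_self[of "r \<otimes> x"] that by (auto simp: FactRing_def)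
  qed
  then show ?thesis
    unfolding associated_primes_def quot_module_simps by (simp add: carrier_quot ann cong: conj_cong)
qed

lemma (in ideal) Union_quot_image:
  assumes "ideal J R" "I \<subseteq> J"
  shows "\<Union>((+>) I ` J) = J"
  using ideal_incl_iff[OF is_ideal assms(1)] assms(2) by simp

text \<open>
  The correspondence of ideals, \<open>quot_ideal_correspondence\<close>, restricts to primes.  Preimages of primes
  are prime in general.  For images, \<open>I \<subseteq> p\<close> makes \<open>p\<close> the full preimage of its image, so that membership
  of a product of cosets can be tested on representatives.
\<close>

lemma (in ideal) quot_prime_correspondence:
  assumes "cring R"
  shows "bij_betw (\<lambda>p. (+>) I ` p) {p. primeideal p R \<and> I \<subseteq> p} {Q. primeideal Q (R Quot I)}"
proof -
  interpret h: ring_hom_ring R "R Quot I" "(+>) I" by (rule rcos_ring_hom_ring)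
  have crQ: "cring (R Quot I)"
    by (rule quotient_is_cring) fact
  have bij: "bij_betw (\<lambda>J. (+>) I ` J) {J. ideal J R \<and> I \<subseteq> J} {J. ideal J (R Quot I)}"
    by (rule quot_ideal_correspondence[OF is_ideal])
  \<comment> \<open>An ideal above \<open>I\<close> is a union of cosets.\<close>
  have pull: "{r \<in> carrier R. I +> r \<in> (+>) I ` J} = J" if J: "ideal J R" "I \<subseteq> J" for J
  proof -
    have "(+>) I ` J \<subseteq> carrier (R Quot I)"
      using carrier_quot ideal.Icarr[OF J(1)] by blast
    then have "I +> r \<in> (+>) I ` J \<longleftrightarrow> r \<in> J" if "r \<in> carrier R" for r
      using canonical_proj_vimage_mem_iff[OF is_ideal _ that, of "(+>) I ` J"] Union_quot_image[OF J]
      by simp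
    then show ?thesis
      using ideal.Icarr[OF J(1)] by auto
  qed
  have image: "primeideal ((+>) I ` p) (R Quot I)" if p: "primeideal p R" "I \<subseteq> p" for p
  proof (rule primeidealI)
    interpret p: primeideal p R by fact
    show "ideal ((+>) I ` p) (R Quot I)"
      by (rule ring_ideal_imp_quot_ideal[OF is_ideal p.is_ideal])
    note pl = pull[OF p.is_ideal p(2)]
    show "carrier (R Quot I) \<noteq> (+>) I ` p"
    proof
      assume eq: "carrier (R Quot I) = (+>) I ` p"
      have "I +> r \<in> (+>) I ` p" if "r \<in> carrier R" for r
        using that unfolding eq[symmetric] carrier_quot by (rule imageI)
      then have "carrier R \<subseteq> p"
        using pl by (metis (mono_tags, lifting) mem_Collect_eq subsetI)
      then show False
        using p.I_notcarr p.a_subset by simp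
    qed
    fix a b assume "a \<in> carrier (R Quot I)" "b \<in> carrier (R Quot I)"
      and ab: "a \<otimes>\<^bsub>R Quot I\<^esub> b \<in> (+>) I ` p"
    then obtain r s where rs: "r \<in> carrier R" "s \<in> carrier R" "a = I +> r" "b = I +> s"
      unfolding carrier_quot by (elim imageE)
    then have "I +> r \<otimes> s \<in> (+>) I ` p"
      using ab by simp
    then have "r \<otimes> s \<in> p"
      using pl m_closed[OF rs(1,2)] by (metis (mono_tags, lifting) mem_Collect_eq)
    then show "a \<in> (+>) I ` p \<or> b \<in> (+>) I ` p"
      using p.I_prime rs by blast
  qed (rule crQ)
  have "\<exists>p. primeideal p R \<and> I \<subseteq> p \<and> Q = (+>) I ` p" if Q: "primeideal Q (R Quot I)" for Q
  proof -
    have "Q \<in> (\<lambda>J. (+>) I ` J) ` {J. ideal J R \<and> I \<subseteq> J}"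
      using bij primeideal.axioms(1)[OF Q] by (simp add: bij_betw_def)
    then obtain J where J: "ideal J R" "I \<subseteq> J" "Q = (+>) I ` J"
      by blast
    moreover have "primeideal J R"
      using h.primeideal_vimage[OF assms Q] pull[OF J(1,2)] J(3) by simp
    ultimately show ?thesis
      by blast
  qed
  then have "(\<lambda>p. (+>) I ` p) ` {p. primeideal p R \<and> I \<subseteq> p} = {Q. primeideal Q (R Quot I)}"
    using image by blast
  moreover have "inj_on (\<lambda>p. (+>) I ` p) {p. primeideal p R \<and> I \<subseteq> p}"
    using primeideal.axioms(1) by (intro inj_on_subset[OF bij_betw_imp_inj_on[OF bij]]) blast
  ultimately show ?thesis
    by (simp add: bij_betw_def)
qed

context finite_prime_antichain
begin

lemma associated_primes_quot_Inter:
  "associated_primes R (quot_module R (\<Inter>F)) = F"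
proof
  show "associated_primes R (quot_module R (\<Inter>F)) \<subseteq> F"
    unfolding ideal.associated_primes_quot_module[OF ideal_Inter]
    using prime_colon_Inter_mem by (auto simp del: Inter_iff)
next
  show "F \<subseteq> associated_primes R (quot_module R (\<Inter>F))"
  proof
    fix p assume p: "p \<in> F"
    then obtain x where "x \<in> carrier R" "{r \<in> carrier R. r \<otimes> x \<in> \<Inter>F} = p"
      using ex_colon_Inter_eq by auto
    then show "p \<in> associated_primes R (quot_module R (\<Inter>F))"
      unfolding ideal.associated_primes_quot_module[OF ideal_Inter]
      using prime_F[OF p] by (intro CollectI conjI bexI[of _ x]) simp_all
  qed
qed

lemma minimal_over_Inter_iff:
  assumes "primeideal p R" "\<Inter>F \<subseteq> p"
  shows "(\<forall>q\<in>{q. primeideal q R \<and> \<Inter>F \<subseteq> q}. q \<subseteq> p \<longrightarrow> q = p) \<longleftrightarrow> p \<in> F"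
proof
  assume min: "\<forall>q\<in>{q. primeideal q R \<and> \<Inter>F \<subseteq> q}. q \<subseteq> p \<longrightarrow> q = p"
  obtain q where "q \<in> F" "q \<subseteq> p"
    using prime_contains_member[OF assms] by blast
  then show "p \<in> F"
    using min prime_F by blast
next
  assume "p \<in> F"
  then show "\<forall>q\<in>{q. primeideal q R \<and> \<Inter>F \<subseteq> q}. q \<subseteq> p \<longrightarrow> q = p"
    using prime_contains_member antichain by blast
qed

text \<open>
  The prime correspondence preserves and reflects inclusion, so it carries the primes minimal over
  \<open>\<Inter>F\<close>, which are the members of \<open>F\<close>, onto the minimal primes of the quotient.
\<close>

lemma minimal_primes_quot_Inter:
  "bij_betw (\<lambda>p. (+>) (\<Inter>F) ` p) F (minimal_primes (R Quot \<Inter>F))"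
proof -
  let ?I = "\<Inter>F" and ?h = "\<lambda>p. (+>) (\<Inter>F) ` p"
  let ?P = "{p. primeideal p R \<and> ?I \<subseteq> p}"
  interpret I: ideal ?I R by (rule ideal_Inter)
  have bij: "bij_betw ?h ?P {Q. primeideal Q (R Quot ?I)}"
    by (rule I.quot_prime_correspondence[OF is_cring])
  have mono: "?h p \<subseteq> ?h q \<longleftrightarrow> p \<subseteq> q" if "p \<in> ?P" "q \<in> ?P" for p q
    using I.Union_quot_image[of p] I.Union_quot_image[of q] that primeideal.axioms(1)
    by (metis (mono_tags, lifting) Union_mono image_mono mem_Collect_eq)
  have inj: "?h p = ?h q \<longleftrightarrow> p = q" if "p \<in> ?P" "q \<in> ?P" for p q
    using bij that by (auto simp: bij_betw_def inj_on_def)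
  have FP: "F \<subseteq> ?P"
    using prime_F by blast
  have primes: "{Q. primeideal Q (R Quot ?I)} = ?h ` ?P"
    using bij by (simp add: bij_betw_def)
  then have prime_iff: "primeideal Q (R Quot ?I) \<longleftrightarrow> Q \<in> ?h ` ?P" for Q
    by blast
  have "minimal_primes (R Quot ?I) = {Q \<in> ?h ` ?P. \<forall>Q'\<in>?h ` ?P. Q' \<subseteq> Q \<longrightarrow> Q' = Q}"
    unfolding minimal_primes_def prime_iff by blast
  also have "\<dots> = ?h ` {p \<in> ?P. \<forall>q\<in>?P. ?h q \<subseteq> ?h p \<longrightarrow> ?h q = ?h p}"
    by (simp only: Compr_image_eq ball_simps)
  also have "{p \<in> ?P. \<forall>q\<in>?P. ?h q \<subseteq> ?h p \<longrightarrow> ?h q = ?h p} = {p \<in> ?P. \<forall>q\<in>?P. q \<subseteq> p \<longrightarrow> q = p}"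
    using mono inj by (intro Collect_cong conj_cong ball_cong refl) simp
  also have "\<dots> = {p \<in> ?P. p \<in> F}"
    using minimal_over_Inter_iff by (intro Collect_cong conj_cong refl) simp
  also have "\<dots> = F"
    using FP by blast
  finally show ?thesis
    using inj_on_subset[OF bij_betw_imp_inj_on[OF bij] FP] by (simp add: bij_betw_def)
qed

end


section \<open>Monomial ideals\<close>

lemma mpoly_ring_simps:
  "monoid.mult (mpoly_ring V) = (*)" "monoid.one (mpoly_ring V) = 1"
  "ring.zero (mpoly_ring V) = 0" "ring.add (mpoly_ring V) = (+)"
  "p \<in> carrier (mpoly_ring V) \<longleftrightarrow> (\<forall>m\<in>Poly_Mapping.keys p. Poly_Mapping.keys m \<subseteq> V)"
  by (simp_all add: mpoly_ring_def)

lemma keys_add_nat: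
  "Poly_Mapping.keys (s + t) = Poly_Mapping.keys s \<union> Poly_Mapping.keys (t :: 'v \<Rightarrow>\<^sub>0 nat)"
  by (auto simp: in_keys_iff lookup_add)

lemma keys_mpoly_mult_split:
  assumes "m \<in> Poly_Mapping.keys (p * q)"
  obtains s t where "m = s + t" "s \<in> Poly_Mapping.keys p" "t \<in> Poly_Mapping.keys q"
  using assms keys_mult[of p q] by blast

lemma ideal_mpoly_ring_monomials:
  assumes up: "\<And>m d. P m \<Longrightarrow> P (m + d)"
  shows "ideal {p \<in> carrier (mpoly_ring V). \<forall>m\<in>Poly_Mapping.keys p. P m}
    (mpoly_ring V :: (('v \<Rightarrow>\<^sub>0 nat) \<Rightarrow>\<^sub>0 'k::field) ring)"
    (is "ideal ?J ?S")
proof -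
  interpret S: cring ?S by (rule cring_mpoly_ring)
  show ?thesis
  proof (rule idealI[OF S.ring_axioms S.add.subgroupI])
    show "?J \<subseteq> carrier ?S"
      by blast
    have "0 \<in> ?J"
      by (simp add: mpoly_ring_simps)
    then show "?J \<noteq> {}"
      by blast
  next
    fix p assume p: "p \<in> ?J"
    then have "- p \<in> ?J"
      by (simp add: mpoly_ring_simps)
    moreover have "\<ominus>\<^bsub>?S\<^esub> p = - p"
      using p \<open>- p \<in> ?J\<close> by (intro S.minus_equality) (simp_all add: mpoly_ring_simps)
    ultimately show "\<ominus>\<^bsub>?S\<^esub> p \<in> ?J"
      by simp
  next
    fix p q assume pq: "p \<in> ?J" "q \<in> ?J"
    then have "p \<oplus>\<^bsub>?S\<^esub> q \<in> carrier ?S"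
      by (intro S.a_closed) simp_all
    then show "p \<oplus>\<^bsub>?S\<^esub> q \<in> ?J"
      using pq keys_add[of p q] by (auto simp: mpoly_ring_simps(4))
  next
    fix p q assume p: "p \<in> ?J" and q: "q \<in> carrier ?S"
    have "P m" if "m \<in> Poly_Mapping.keys (p * q)" for m
      using that p up by (auto elim!: keys_mpoly_mult_split)
    then show "p \<otimes>\<^bsub>?S\<^esub> q \<in> ?J"
      using p q S.m_closed[of p q] by (simp add: mpoly_ring_simps(1))
    then show "q \<otimes>\<^bsub>?S\<^esub> p \<in> ?J"
      using p q S.m_comm[of p q] by simp
  qed
qed

text \<open>
  The right-hand side is an ideal because a multiple of a multiple of \<open>g\<close> is a multiple of \<open>g\<close>.  That it
  is no larger than the generated ideal follows by building up a polynomial term by term: each term is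
  a multiple of a generator on its own.
\<close>

lemma genideal_monomials:
  assumes G: "\<And>g. g \<in> G \<Longrightarrow> Poly_Mapping.keys g \<subseteq> V"
  shows "genideal (mpoly_ring V :: (('v \<Rightarrow>\<^sub>0 nat) \<Rightarrow>\<^sub>0 'k::field) ring)
      ((\<lambda>g. Poly_Mapping.single g 1) ` G)
    = {p \<in> carrier (mpoly_ring V). \<forall>m\<in>Poly_Mapping.keys p. \<exists>g\<in>G. \<exists>d. m = g + d}"
    (is "genideal ?S ?X = ?J")
proof -
  interpret S: cring ?S by (rule cring_mpoly_ring)
  have X: "?X \<subseteq> carrier ?S"
    using G by (auto simp: mpoly_ring_simps)
  interpret X: ideal "genideal ?S ?X" ?S by (rule S.genideal_ideal[OF X])
  show ?thesis
  proof
    have "ideal ?J ?S"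
    proof (rule ideal_mpoly_ring_monomials)
      fix m d assume "\<exists>g\<in>G. \<exists>e. m = g + e"
      then show "\<exists>g\<in>G. \<exists>e. m + d = g + e"
        by (metis add.assoc)
    qed
    moreover have "?X \<subseteq> ?J"
    proof -
      have "\<exists>h\<in>G. \<exists>d. g = h + d" if "g \<in> G" for g
        using that by (intro bexI[of _ g] exI[of _ 0]) simp_all
      then show ?thesis
        using X by auto
    qed
    ultimately show "genideal ?S ?X \<subseteq> ?J"
      by (rule S.genideal_minimal)
  next
    have "p \<in> ?J \<longrightarrow> p \<in> genideal ?S ?X" for p
    proof (induction p rule: update_induct)
      case const
      then show ?case
        using X.zero_closed by (simp add: mpoly_ring_simps)
    next
      case (update p m c)
      have eq: "Poly_Mapping.update m c p = p + Poly_Mapping.single m c"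
        using update.hyps(1)
        by (intro poly_mapping_eqI) (auto simp: lookup_update lookup_add lookup_single in_keys_iff when_def)
      show ?case
      proof
        assume J: "Poly_Mapping.update m c p \<in> ?J"
        then have p: "p \<in> ?J" and m: "Poly_Mapping.keys m \<subseteq> V" "\<exists>g\<in>G. \<exists>d. m = g + d"
          using update.hyps(2) by (auto simp: mpoly_ring_simps keys_update)
        then obtain g d where g: "g \<in> G" "m = g + d"
          by blast
        have "Poly_Mapping.single d c \<in> carrier ?S"
          using m(1) g(2) by (auto simp: mpoly_ring_simps keys_add_nat)
        then have "Poly_Mapping.single g 1 \<otimes>\<^bsub>?S\<^esub> Poly_Mapping.single d c \<in> genideal ?S ?X"
          using S.genideal_self[OF X] g(1) by (intro X.I_r_closed) blast
        then have "Poly_Mapping.single m c \<in> genideal ?S ?X"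
          by (simp add: mpoly_ring_simps mult_single g(2))
        then show "Poly_Mapping.update m c p \<in> genideal ?S ?X"
          using X.a_closed[of p] update.IH p by (simp add: eq mpoly_ring_simps(4))
      qed
    qed
    then show "?J \<subseteq> genideal ?S ?X"
      by blast
  qed
qed

text \<open>
  The pair of lexicographic maxima would do, but it would need a linear order on the variables.
  Instead, as long as one of the two sets is not a singleton, pick a coordinate \<open>v\<close> that separates two
  of its elements, and pass to the elements of \<open>K\<close> and of \<open>L\<close> with maximal \<open>v\<close>-coordinate.  One
  set shrinks, and nothing outside can interfere: a sum whose \<open>v\<close>-coordinate is the sum of
  the two maxima has both summands in the smaller sets.
\<close>

lemma ex_unique_sum:
  fixes K L :: "('v \<Rightarrow>\<^sub>0 nat) set"
  assumes "finite K" "finite L" "K \<noteq> {}" "L \<noteq> {}"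
  shows "\<exists>k\<in>K. \<exists>l\<in>L. \<forall>k'\<in>K. \<forall>l'\<in>L. k' + l' = k + l \<longrightarrow> k' = k \<and> l' = l"
  using assms
proof (induction "card K + card L" arbitrary: K L rule: less_induct)
  case less
  let ?sep = "\<lambda>A v. \<exists>m\<in>A. \<exists>m'\<in>A. Poly_Mapping.lookup m v \<noteq> Poly_Mapping.lookup m' v"
  show ?case
  proof (cases "\<exists>v. ?sep K v \<or> ?sep L v")
    case True
    then obtain v where v: "?sep K v \<or> ?sep L v"
      by blast
    define top where
      "top A = {m \<in> A. Poly_Mapping.lookup m v = Max ((\<lambda>m. Poly_Mapping.lookup m v) ` A)}"
      for A :: "('v \<Rightarrow>\<^sub>0 nat) set"
    have top: "top A \<noteq> {}" "top A \<subseteq> A" "finite (top A)"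
      and le: "\<And>m. m \<in> A \<Longrightarrow> Poly_Mapping.lookup m v \<le> Max ((\<lambda>m. Poly_Mapping.lookup m v) ` A)"
      if "finite A" "A \<noteq> {}" for A
    proof -
      have "Max ((\<lambda>m. Poly_Mapping.lookup m v) ` A) \<in> (\<lambda>m. Poly_Mapping.lookup m v) ` A"
        using that by (intro Max_in) auto
      then show "top A \<noteq> {}"
        unfolding top_def by auto
    qed (use that in \<open>auto simp: top_def\<close>)
    note K = top[OF less.prems(1,3)] and L = top[OF less.prems(2,4)]
    have "top K \<noteq> K \<or> top L \<noteq> L"
    proof (rule ccontr)
      assume "\<not> ?thesis"
      then have "\<forall>k\<in>K. Poly_Mapping.lookup k v = Max ((\<lambda>m. Poly_Mapping.lookup m v) ` K)"
        "\<forall>l\<in>L. Poly_Mapping.lookup l v = Max ((\<lambda>m. Poly_Mapping.lookup m v) ` L)"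
        unfolding top_def by blast+
      with v show False
        by metis
    qed
    then have "top K \<subset> K \<or> top L \<subset> L"
      using K(2) L(2) by blast
    then have "card (top K) < card K \<or> card (top L) < card L"
      using psubset_card_mono less.prems(1,2) by blast
    then have "card (top K) + card (top L) < card K + card L"
      using card_mono[OF less.prems(1) K(2)] card_mono[OF less.prems(2) L(2)] by linarith
    from less.hyps[OF this K(3) L(3) K(1) L(1)]
    obtain k l where kl: "k \<in> top K" "l \<in> top L"
      and uniq: "\<forall>k'\<in>top K. \<forall>l'\<in>top L. k' + l' = k + l \<longrightarrow> k' = k \<and> l' = l"
      by blast
    have "k' = k \<and> l' = l" if "k' \<in> K" "l' \<in> L" "k' + l' = k + l" for k' l'
    proof -
      have "Poly_Mapping.lookup k' v + Poly_Mapping.lookup l' v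
          = Poly_Mapping.lookup k v + Poly_Mapping.lookup l v"
        using that(3) by (metis lookup_add)
      then have "k' \<in> top K" "l' \<in> top L"
        using kl le[OF less.prems(1,3) that(1)] le[OF less.prems(2,4) that(2)] that
        unfolding top_def by auto
      then show ?thesis
        using uniq that(3) by blast
    qed
    then show ?thesis
      using kl K(2) L(2) by blast
  next
    case False
    then have "k = k'" if "k \<in> K" "k' \<in> K" for k k'
      using that by (intro poly_mapping_eqI) blast
    moreover from False have "l = l'" if "l \<in> L" "l' \<in> L" for l l'
      using that by (intro poly_mapping_eqI) blast
    ultimately show ?thesis
      using less.prems by blast
  qed
qed

text \<open>
  If \<open>k + l\<close> arises only from \<open>k\<close> and \<open>l\<close>, no other pair of terms can cancel the product of the two
  coefficients.
\<close>

lemma mem_keys_mult_unique_sum: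
  fixes p q :: "('v \<Rightarrow>\<^sub>0 nat) \<Rightarrow>\<^sub>0 'k::field"
  assumes "k \<in> Poly_Mapping.keys p" "l \<in> Poly_Mapping.keys q"
    and uniq: "\<And>k' l'. \<lbrakk>k' \<in> Poly_Mapping.keys p; l' \<in> Poly_Mapping.keys q; k' + l' = k + l\<rbrakk>
      \<Longrightarrow> k' = k \<and> l' = l"
  shows "k + l \<in> Poly_Mapping.keys (p * q)"
proof -
  \<comment> \<open>The terms of \<open>p\<close> at \<open>k\<close> and of \<open>q\<close> at \<open>l\<close>; only their product contributes to \<open>k + l\<close>.\<close>
  define c d where "c = Poly_Mapping.single k (Poly_Mapping.lookup p k)"
    and "d = Poly_Mapping.single l (Poly_Mapping.lookup q l)"
  have kp: "Poly_Mapping.keys (p - c) \<subseteq> Poly_Mapping.keys p - {k}"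
    and kq: "Poly_Mapping.keys (q - d) \<subseteq> Poly_Mapping.keys q - {l}"
    by (auto simp: c_def d_def in_keys_iff lookup_minus lookup_single when_def split: if_splits)
  have kc: "Poly_Mapping.keys c \<subseteq> {k}"
    by (simp add: c_def)
  have "k + l \<notin> Poly_Mapping.keys (c * (q - d))"
  proof
    assume "k + l \<in> Poly_Mapping.keys (c * (q - d))"
    then obtain s t where st: "k + l = s + t" "s \<in> Poly_Mapping.keys c" "t \<in> Poly_Mapping.keys (q - d)"
      by (rule keys_mpoly_mult_split)
    then have "s = k"
      using kc by blast
    with st(1) have "t = l"
      by simp
    then show False
      using st(3) kq by blast
  qed
  moreover have "k + l \<notin> Poly_Mapping.keys ((p - c) * q)"
  proof
    assume "k + l \<in> Poly_Mapping.keys ((p - c) * q)"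
    then obtain s t where st: "k + l = s + t" "s \<in> Poly_Mapping.keys (p - c)" "t \<in> Poly_Mapping.keys q"
      by (rule keys_mpoly_mult_split)
    then have "s = k"
      using kp uniq[of s t] by auto
    then show False
      using st(2) kp by blast
  qed
  moreover have "p * q = c * d + c * (q - d) + (p - c) * q"
    by (simp add: algebra_simps)
  ultimately have "Poly_Mapping.lookup (p * q) (k + l) = Poly_Mapping.lookup (c * d) (k + l)"
    by (simp add: lookup_add in_keys_iff)
  also have "\<dots> = Poly_Mapping.lookup p k * Poly_Mapping.lookup q l"
    by (simp add: c_def d_def mult_single)
  finally show ?thesis
    using assms(1,2) by (simp add: in_keys_iff)
qed

text \<open>
  The ideal generated by the variables in \<open>A\<close> (see \<open>genideal_var\<close> below), described by its elements: this form
  turns inclusions and intersections of such ideals into statements about supports of monomials.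
\<close>

definition hitting_ideal :: "'v set \<Rightarrow> 'v set \<Rightarrow> (('v \<Rightarrow>\<^sub>0 nat) \<Rightarrow>\<^sub>0 'k::field) set"
  where "hitting_ideal V A =
    {p \<in> carrier (mpoly_ring V). \<forall>m\<in>Poly_Mapping.keys p. Poly_Mapping.keys m \<inter> A \<noteq> {}}"

lemma genideal_var:
  assumes "A \<subseteq> V"
  shows "genideal (mpoly_ring V :: (('v \<Rightarrow>\<^sub>0 nat) \<Rightarrow>\<^sub>0 'k::field) ring) (var ` A) = hitting_ideal V A"
    (is "genideal ?S _ = _")
proof -
  let ?G = "(\<lambda>v. Poly_Mapping.single v (1::nat)) ` A"
  have div: "(\<exists>d. m = Poly_Mapping.single v 1 + d) \<longleftrightarrow> v \<in> Poly_Mapping.keys m"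
    for v and m :: "'v \<Rightarrow>\<^sub>0 nat"
  proof
    assume v: "v \<in> Poly_Mapping.keys m"
    have "m = Poly_Mapping.single v 1 + (m - Poly_Mapping.single v 1)"
      using v by (intro poly_mapping_eqI) (auto simp: lookup_add lookup_minus lookup_single when_def in_keys_iff)
    then show "\<exists>d. m = Poly_Mapping.single v 1 + d" ..
  qed (auto simp: keys_add_nat)
  have "genideal ?S (var ` A) = genideal ?S ((\<lambda>g. Poly_Mapping.single g 1) ` ?G)"
    by (simp add: var_def image_image)
  also have "\<dots> = {p \<in> carrier ?S. \<forall>m\<in>Poly_Mapping.keys p. \<exists>g\<in>?G. \<exists>d. m = g + d}"
    using assms by (intro genideal_monomials) auto
  also have "(\<lambda>m. \<exists>g\<in>?G. \<exists>d. m = g + d) = (\<lambda>m. Poly_Mapping.keys m \<inter> A \<noteq> {})"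
    by (simp only: bex_simps div) blast
  finally show ?thesis
    by (simp only: hitting_ideal_def)
qed

text \<open>
  Two polynomials outside the ideal have monomials that avoid \<open>A\<close>.  A sum of exponents avoids \<open>A\<close> only if
  both summands do, so a sum that is unique among the monomials avoiding \<open>A\<close> is unique among all
  monomials, and its monomial occurs in the product.
\<close>

lemma primeideal_hitting_ideal:
  "primeideal (hitting_ideal V A) (mpoly_ring V :: (('v \<Rightarrow>\<^sub>0 nat) \<Rightarrow>\<^sub>0 'k::field) ring)"
    (is "primeideal _ ?S")
proof (rule primeidealI)
  show "ideal (hitting_ideal V A) ?S"
    unfolding hitting_ideal_def by (rule ideal_mpoly_ring_monomials) (auto simp: keys_add_nat)
  show "cring ?S"
    by (rule cring_mpoly_ring)
  have "1 \<in> carrier ?S" "1 \<notin> hitting_ideal V A"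
    by (simp_all add: mpoly_ring_simps hitting_ideal_def)
  then show "carrier ?S \<noteq> hitting_ideal V A"
    by blast
  fix p q assume p: "p \<in> carrier ?S" and q: "q \<in> carrier ?S"
    and pq: "p \<otimes>\<^bsub>?S\<^esub> q \<in> hitting_ideal V A"
  show "p \<in> hitting_ideal V A \<or> q \<in> hitting_ideal V A"
  proof (rule ccontr)
    let ?avoid = "\<lambda>r. {m \<in> Poly_Mapping.keys r. Poly_Mapping.keys m \<inter> A = {}}"
    assume "\<not> ?thesis"
    then have "?avoid p \<noteq> {}" "?avoid q \<noteq> {}"
      using p q by (auto simp: hitting_ideal_def)
    then obtain k l where kl: "k \<in> ?avoid p" "l \<in> ?avoid q"
      and uniq: "\<forall>k'\<in>?avoid p. \<forall>l'\<in>?avoid q. k' + l' = k + l \<longrightarrow> k' = k \<and> l' = l"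
      using ex_unique_sum[of "?avoid p" "?avoid q"] by auto
    have avoid: "Poly_Mapping.keys (k + l) \<inter> A = {}"
      using kl by (auto simp: keys_add_nat)
    have "k + l \<in> Poly_Mapping.keys (p * q)"
    proof (rule mem_keys_mult_unique_sum)
      fix k' l' assume "k' \<in> Poly_Mapping.keys p" "l' \<in> Poly_Mapping.keys q" and eq: "k' + l' = k + l"
      moreover have "Poly_Mapping.keys k' \<inter> A = {}" "Poly_Mapping.keys l' \<inter> A = {}"
        using avoid unfolding eq[symmetric] keys_add_nat by blast+
      ultimately show "k' = k \<and> l' = l"
        using uniq by blast
    qed (use kl in auto)
    then show False
      using pq avoid by (auto simp: hitting_ideal_def mpoly_ring_simps)
  qed
qed

lemma hitting_ideal_subset_iff:
  assumes "A \<subseteq> V"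
  shows "(hitting_ideal V A :: (('v \<Rightarrow>\<^sub>0 nat) \<Rightarrow>\<^sub>0 'k::field) set) \<subseteq> hitting_ideal V B \<longleftrightarrow> A \<subseteq> B"
proof
  assume sub: "(hitting_ideal V A :: (('v \<Rightarrow>\<^sub>0 nat) \<Rightarrow>\<^sub>0 'k) set) \<subseteq> hitting_ideal V B"
  show "A \<subseteq> B"
  proof
    fix v assume "v \<in> A"
    then have "(var v :: ('v \<Rightarrow>\<^sub>0 nat) \<Rightarrow>\<^sub>0 'k) \<in> hitting_ideal V A"
      using assms by (auto simp: hitting_ideal_def var_def mpoly_ring_simps)
    then have "(var v :: ('v \<Rightarrow>\<^sub>0 nat) \<Rightarrow>\<^sub>0 'k) \<in> hitting_ideal V B"
      using sub by blast
    then show "v \<in> B"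
      by (simp add: hitting_ideal_def var_def)
  qed
next
  assume "A \<subseteq> B"
  then show "(hitting_ideal V A :: (('v \<Rightarrow>\<^sub>0 nat) \<Rightarrow>\<^sub>0 'k) set) \<subseteq> hitting_ideal V B"
    unfolding hitting_ideal_def by blast
qed


section \<open>The edge ideal of the prime ideal graph\<close>

text \<open>
  An edge has two distinct endpoints, so the product of its variables is squarefree and divides a
  monomial as soon as both variables occur.  For a loop at \<open>x\<close>, the square of the variable would be needed.
\<close>

lemma edge_ideal_eq_monomials_containing_edge:
  fixes V :: "'v set"
  assumes loopfree: "\<And>x. {x} \<notin> E" and edges: "\<And>e. e \<in> E \<Longrightarrow> e \<subseteq> V"
  shows "(edge_ideal (V, E) :: (('v \<Rightarrow>\<^sub>0 nat) \<Rightarrow>\<^sub>0 'k::field) set) = {p \<in> carrier (mpoly_ring V).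
    \<forall>m\<in>Poly_Mapping.keys p. \<exists>x y. {x, y} \<in> E \<and> x \<in> Poly_Mapping.keys m \<and> y \<in> Poly_Mapping.keys m}"
proof -
  let ?S = "mpoly_ring V :: (('v \<Rightarrow>\<^sub>0 nat) \<Rightarrow>\<^sub>0 'k) ring"
  let ?s = "\<lambda>v. Poly_Mapping.single v (1::nat)"
  let ?G = "{?s x + ?s y | x y. {x, y} \<in> E}"
  have div: "(\<exists>d. m = ?s x + ?s y + d) \<longleftrightarrow> x \<in> Poly_Mapping.keys m \<and> y \<in> Poly_Mapping.keys m"
    if "{x, y} \<in> E" for x y and m :: "'v \<Rightarrow>\<^sub>0 nat"
  proof
    assume xy: "x \<in> Poly_Mapping.keys m \<and> y \<in> Poly_Mapping.keys m"
    have "x \<noteq> y"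
      using that loopfree by auto
    then have "m = ?s x + ?s y + (m - (?s x + ?s y))"
      using xy by (intro poly_mapping_eqI) (auto simp: lookup_add lookup_minus lookup_single when_def in_keys_iff)
    then show "\<exists>d. m = ?s x + ?s y + d" ..
  qed (auto simp: keys_add_nat)
  have gens: "{var x * var y | x y. {x, y} \<in> E}
      = (\<lambda>g. Poly_Mapping.single g 1 :: ('v \<Rightarrow>\<^sub>0 nat) \<Rightarrow>\<^sub>0 'k) ` ?G"
    by (auto simp: var_def mult_single)
  have "edge_ideal (V, E) = genideal ?S ((\<lambda>g. Poly_Mapping.single g 1) ` ?G)"
    unfolding edge_ideal_def fst_conv snd_conv gens ..
  also have "\<dots> = {p \<in> carrier ?S. \<forall>m\<in>Poly_Mapping.keys p. \<exists>g\<in>?G. \<exists>d. m = g + d}"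
    using edges by (intro genideal_monomials) (fastforce simp: keys_add_nat)
  also have "(\<lambda>m. \<exists>g\<in>?G. \<exists>d. m = g + d) =
      (\<lambda>m. \<exists>x y. {x, y} \<in> E \<and> x \<in> Poly_Mapping.keys m \<and> y \<in> Poly_Mapping.keys m)"
  proof
    fix m
    have "(\<exists>g\<in>?G. \<exists>d. m = g + d) \<longleftrightarrow> (\<exists>x y. {x, y} \<in> E \<and> (\<exists>d. m = ?s x + ?s y + d))"
      by blast
    then show "(\<exists>g\<in>?G. \<exists>d. m = g + d) \<longleftrightarrow>
        (\<exists>x y. {x, y} \<in> E \<and> x \<in> Poly_Mapping.keys m \<and> y \<in> Poly_Mapping.keys m)"
      by (simp only: div cong: conj_cong)
  qed
  finally show ?thesis .
qed

text \<open>
  A set of vertices contains an edge if and only if it meets \<open>W\<close> and each \<open>V - {w}\<close>.  If it meets \<open>W\<close> in \<open>w\<close>,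
  a second element, provided by \<open>V - {w}\<close>, forms an edge with \<open>w\<close>.  Conversely, an edge has an endpoint
  in \<open>W\<close>, and its two endpoints cannot both be \<open>w\<close>.
\<close>

lemma edge_ideal_prime_ideal_graph:
  fixes R (structure)
  assumes "primeideal P R"
  defines "V \<equiv> carrier R - {\<zero>}" and "W \<equiv> P - {\<zero>}"
  shows "edge_ideal (prime_ideal_graph R P)
    = \<Inter>(hitting_ideal V ` insert W ((\<lambda>w. V - {w}) ` W))"
proof -
  interpret P: primeideal P R by fact
  let ?E = "{{x, y} | x y. x \<in> V \<and> y \<in> V \<and> x \<noteq> y \<and> x \<otimes> y \<in> P}"
  have WV: "W \<subseteq> V"
    using P.a_subset unfolding V_def W_def by blast
  have graph: "prime_ideal_graph R P = (V, ?E)"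
    by (simp add: prime_ideal_graph_def V_def)
  have edge: "{x, y} \<in> ?E \<longleftrightarrow> x \<in> V \<and> y \<in> V \<and> x \<noteq> y \<and> (x \<in> W \<or> y \<in> W)" for x y
  proof -
    have "x \<otimes> y \<in> P \<longleftrightarrow> x \<in> W \<or> y \<in> W" if "x \<in> V" "y \<in> V" for x y
      using that P.I_prime[of x y] P.I_l_closed[of y x] P.I_r_closed[of x y]
      unfolding V_def W_def by blast
    then show ?thesis
      by (auto simp: doubleton_eq_iff)
  qed
  have mon: "(\<exists>x y. {x, y} \<in> ?E \<and> x \<in> M \<and> y \<in> M) \<longleftrightarrow>
      M \<inter> W \<noteq> {} \<and> (\<forall>w\<in>W. M \<inter> (V - {w}) \<noteq> {})" if "M \<subseteq> V" for M
  proof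
    assume "\<exists>x y. {x, y} \<in> ?E \<and> x \<in> M \<and> y \<in> M"
    then show "M \<inter> W \<noteq> {} \<and> (\<forall>w\<in>W. M \<inter> (V - {w}) \<noteq> {})"
      unfolding edge by blast
  next
    assume hit: "M \<inter> W \<noteq> {} \<and> (\<forall>w\<in>W. M \<inter> (V - {w}) \<noteq> {})"
    then obtain w where w: "w \<in> M" "w \<in> W"
      by blast
    with hit obtain z where "z \<in> M" "z \<in> V" "z \<noteq> w"
      by blast
    with w WV show "\<exists>x y. {x, y} \<in> ?E \<and> x \<in> M \<and> y \<in> M"
      unfolding edge by blast
  qed
  have "edge_ideal (prime_ideal_graph R P) = {p \<in> carrier (mpoly_ring V).
      \<forall>m\<in>Poly_Mapping.keys p. \<exists>x y. {x, y} \<in> ?E \<and> x \<in> Poly_Mapping.keys m \<and> y \<in> Poly_Mapping.keys m}"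
    unfolding graph by (rule edge_ideal_eq_monomials_containing_edge) auto
  also have "\<dots> = {p \<in> carrier (mpoly_ring V). \<forall>m\<in>Poly_Mapping.keys p.
      Poly_Mapping.keys m \<inter> W \<noteq> {} \<and> (\<forall>w\<in>W. Poly_Mapping.keys m \<inter> (V - {w}) \<noteq> {})}"
    by (intro Collect_cong conj_cong ball_cong refl mon) (simp add: mpoly_ring_simps)
  also have "\<dots> = \<Inter>(hitting_ideal V ` insert W ((\<lambda>w. V - {w}) ` W))"
    by (auto simp: hitting_ideal_def)
  finally show ?thesis .
qed

theorem corollary3p3:
  fixes R :: "('r, 'e) ring_scheme"
    and P :: "'r set"
    and m a b :: nat
    and u v :: "nat \<Rightarrow> 'r"
    and x y :: "nat \<Rightarrow> (('r \<Rightarrow>\<^sub>0 nat) \<Rightarrow>\<^sub>0 'k::field)"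
    and S :: "(('r \<Rightarrow>\<^sub>0 nat) \<Rightarrow>\<^sub>0 'k) ring"
    and I :: "(('r \<Rightarrow>\<^sub>0 nat) \<Rightarrow>\<^sub>0 'k) set"
    and \<pp> :: "nat \<Rightarrow> (('r \<Rightarrow>\<^sub>0 nat) \<Rightarrow>\<^sub>0 'k) set"
  assumes "cring R" and "finite (carrier R)"
    and "primeideal P R"
    and "m = card P" and "m \<ge> 2"
    and "a = m - 1" and "b = card (carrier R - P)"
    and "bij_betw u {1..a} (P - {\<zero>\<^bsub>R\<^esub>})"
    and "bij_betw v {1..b} (carrier R - P)"
    and "\<And>i. i \<in> {1..a} \<Longrightarrow> x i = var (u i)"
    and "\<And>l. l \<in> {1..b} \<Longrightarrow> y l = var (v l)"
    and "S = mpoly_ring (u ` {1..a} \<union> v ` {1..b})"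
    and "I = edge_ideal (prime_ideal_graph R P)"
    and "\<pp> 0 = Idl\<^bsub>S\<^esub> (x ` {1..a})"
    and "\<And>i. i \<in> {1..a} \<Longrightarrow> \<pp> i = Idl\<^bsub>S\<^esub> (x ` ({1..a} - {i}) \<union> y ` {1..b})"
  shows "I = (\<Inter>i\<in>{0..a}. \<pp> i)
    \<and> is_radical S I
    \<and> associated_primes S (quot_module S I) = \<pp> ` {0..a}
    \<and> card (minimal_primes (S Quot I)) = m"
proof -
  let ?V = "carrier R - {\<zero>\<^bsub>R\<^esub>}" and ?W = "P - {\<zero>\<^bsub>R\<^esub>}"
  let ?H = "hitting_ideal ?V :: 'r set \<Rightarrow> (('r \<Rightarrow>\<^sub>0 nat) \<Rightarrow>\<^sub>0 'k) set"
  \<comment> \<open>The variables that generate \<open>\<pp> i\<close>.\<close>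
  let ?C = "\<lambda>i. if i = 0 then ?W else ?V - {u i}"
  interpret P: primeideal P R by fact
  have zero_P: "\<zero>\<^bsub>R\<^esub> \<in> P"
    by (rule additive_subgroup.zero_closed[OF P.additive_subgroup_axioms])
  have uW: "u ` {1..a} = ?W" and vQ: "v ` {1..b} = carrier R - P"
    and inj_u: "inj_on u {1..a}"
    using assms(8,9) by (auto simp: bij_betw_def)
  have WV: "?W \<subseteq> ?V"
    using P.a_subset by blast
  have V: "u ` {1..a} \<union> v ` {1..b} = ?V"
    unfolding uW vQ using P.a_subset zero_P by blast
  have Q: "carrier R - P \<noteq> {}"
    using P.I_notcarr P.a_subset by blast
  have uW': "u i \<in> ?W" if "i \<in> {1..a}" for i
    using uW that by blast
  have S: "S = mpoly_ring ?V"
    using assms(12) V by simp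
  have CV: "?C i \<subseteq> ?V" for i
    using WV by simp
  have \<pp>: "\<pp> i = ?H (?C i)" if "i \<in> {0..a}" for i
  proof (cases "i = 0")
    case True
    have "x ` {1..a} = var ` ?W"
      unfolding uW[symmetric] image_image using assms(10) by (intro image_cong) auto
    then show ?thesis
      using True genideal_var[OF WV] by (simp add: assms(14) S)
  next
    case False
    then have i: "i \<in> {1..a}"
      using that by simp
    have "x ` ({1..a} - {i}) = var ` (u ` ({1..a} - {i}))"
      unfolding image_image using assms(10) by (intro image_cong) auto
    moreover have "y ` {1..b} = var ` (v ` {1..b})"
      unfolding image_image using assms(11) by (intro image_cong) auto
    moreover have "u ` ({1..a} - {i}) \<union> v ` {1..b} = ?V - {u i}"
    proof -
      have "u ` ({1..a} - {i}) = u ` {1..a} - {u i}"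
        using inj_on_image_set_diff[OF inj_u, of "{1..a}" "{i}"] i by simp
      moreover have "u i \<notin> v ` {1..b}"
        using uW'[OF i] vQ by blast
      ultimately show ?thesis
        unfolding V[symmetric] Un_Diff by simp
    qed
    ultimately have "x ` ({1..a} - {i}) \<union> y ` {1..b} = var ` (?V - {u i})"
      by (metis image_Un)
    then show ?thesis
      using False genideal_var[of "?V - {u i}" ?V] by (simp add: assms(15)[OF i] S)
  qed
  \<comment> \<open>As \<open>P\<close> is proper, \<open>V - {u i}\<close> contains elements outside \<open>P\<close>, hence is not contained in \<open>W\<close>.\<close>
  have C_incomparable: "i = j" if ij: "i \<in> {0..a}" "j \<in> {0..a}" and sub: "?C i \<subseteq> ?C j" for i j
  proof -
    consider "i = 0" "j = 0" | "i = 0" "j \<in> {1..a}" | "i \<in> {1..a}" "j = 0"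
      | "i \<in> {1..a}" "j \<in> {1..a}"
      using ij by fastforce
    then show ?thesis
    proof cases
      case 2
      then show ?thesis
        using sub uW' by auto
    next
      case 3
      obtain z where z: "z \<in> carrier R" "z \<notin> P"
        using Q by blast
      then have "z \<in> ?C i"
        using 3 uW'[of i] zero_P by auto
      then show ?thesis
        using sub 3 z by auto
    next
      case 4
      then have "u i = u j"
        using sub uW'[of j] WV by auto
      then show ?thesis
        using inj_onD[OF inj_u] 4 by simp
    qed simp
  qed
  have \<pp>_sub: "i = j" if "i \<in> {0..a}" "j \<in> {0..a}" "\<pp> i \<subseteq> \<pp> j" for i j
  proof -
    have "?H (?C i) \<subseteq> ?H (?C j)"
      using that(3) unfolding \<pp>[OF that(1)] \<pp>[OF that(2)] .
    then show ?thesis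
      using C_incomparable[OF that(1,2)] unfolding hitting_ideal_subset_iff[OF CV] by blast
  qed
  interpret finite_prime_antichain S "\<pp> ` {0..a}"
  proof (intro finite_prime_antichain.intro finite_prime_antichain_axioms.intro)
    show "cring S"
      unfolding S by (rule cring_mpoly_ring)
    show "primeideal p S" if "p \<in> \<pp> ` {0..a}" for p
    proof -
      from that obtain i where i: "i \<in> {0..a}" "p = \<pp> i"
        by blast
      show ?thesis
        unfolding i(2) \<pp>[OF i(1)] S by (rule primeideal_hitting_ideal)
    qed
    show "p = q" if "p \<in> \<pp> ` {0..a}" "q \<in> \<pp> ` {0..a}" "p \<subseteq> q" for p q
      using that \<pp>_sub by blast
  qed simp_all
  have "I = \<Inter>(?H ` insert ?W ((\<lambda>w. ?V - {w}) ` ?W))"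
    using edge_ideal_prime_ideal_graph[OF assms(3)] assms(13) by simp
  also have "insert ?W ((\<lambda>w. ?V - {w}) ` ?W) = ?C ` {0..a}"
  proof -
    have "{0..a} = insert 0 {1..a}"
      by auto
    moreover have "(\<lambda>w. ?V - {w}) ` ?W = ?C ` {1..a}"
      unfolding uW[symmetric] image_image by (intro image_cong) auto
    ultimately show ?thesis
      by (simp only: image_insert if_True simp_thms)
  qed
  also have "?H ` ?C ` {0..a} = \<pp> ` {0..a}"
    unfolding image_image by (intro image_cong refl \<pp>[symmetric])
  finally have I: "I = \<Inter>(\<pp> ` {0..a})" .
  have "card (minimal_primes (S Quot I)) = card (\<pp> ` {0..a})"
    using bij_betw_same_card[OF minimal_primes_quot_Inter] I by simp
  also have "\<dots> = card {0..a}"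
    using \<pp>_sub by (intro card_image inj_onI) blast
  also have "\<dots> = m"
    using assms(5,6) by simp
  finally have "card (minimal_primes (S Quot I)) = m" .
  then show ?thesis
    using I is_radical_Inter associated_primes_quot_Inter by simp
qed

end
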